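(* Let $G$ be a graph on $n\ge 2$ vertices. Then $b(G)\le \mathrm{iso}(G)$.
   Context: Graphs are finite, simple, undirected and unweighted. For a graph $G$ with vertex set $V(G)$, $|V(G)|=n\ge 2$, and edge set $E(G)$, the $\ell_1$-Fiedler value is $$b(G)=\min\Big\{\sum_{uv\in E(G)}|x_u-x_v| : x\in\mathbb{R}^{V(G)},\ \sum_{v\in V(G)}x_v=0,\ \sum_{v\in V(G)}|x_v|=1\Big\}.$$ For nonempty $S\subsetneq V(G)$, $S^c=V(G)\setminus S$, let $\partial S=\{uv\in E(G):u\in S,\ v\in S^c\}$. The isoperimetric number is $\mathrm{iso}(G)=\min\{|\partial S|/|S| : S\subseteq V(G),\ 0<|S|\le \lfloor n/2\rfloor\}$. *)

theory Defs
  imports "HOL-Analysis.Analysis"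
begin

definition simple_graph :: "'a set \<Rightarrow> 'a set set \<Rightarrow> bool" where
  "simple_graph V E \<longleftrightarrow> finite V \<and> (\<forall>e\<in>E. e \<subseteq> V \<and> card e = 2)"

text \<open>The value of \<open>\<bar>x u - x v\<bar>\<close> on the unordered edge \<open>{u, v}\<close>; it does not depend on the
  order of the endpoints, see \<open>edge_diff_insert\<close>.\<close>

definition edge_diff :: "('a \<Rightarrow> real) \<Rightarrow> 'a set \<Rightarrow> real" where
  "edge_diff x e = (THE d. \<exists>u v. e = {u, v} \<and> d = \<bar>x u - x v\<bar>)"

lemma edge_diff_insert: "edge_diff x {u, v} = \<bar>x u - x v\<bar>"
  unfolding edge_diff_def
  by (rule the_equality) (auto simp: doubleton_eq_iff abs_minus_commute)

definition energy :: "'a set set \<Rightarrow> ('a \<Rightarrow> real) \<Rightarrow> real" where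
  "energy E x = (\<Sum>e\<in>E. edge_diff x e)"

text \<open>Vectors in \<open>\<real>\<^sup>V\<close> are functions on the whole type; their values outside \<open>V\<close> are irrelevant.\<close>

definition feasible :: "'a set \<Rightarrow> ('a \<Rightarrow> real) set" where
  "feasible V = {x. (\<Sum>v\<in>V. x v) = 0 \<and> (\<Sum>v\<in>V. \<bar>x v\<bar>) = 1}"

text \<open>\<open>Min\<close> is only meaningful for finite sets, so the minimum is taken with \<open>LEAST\<close>;
  it is attained by \<open>fiedler_l1_attained\<close>.\<close>

definition fiedler_l1 :: "'a set \<Rightarrow> 'a set set \<Rightarrow> real" where
  "fiedler_l1 V E = (LEAST r. r \<in> energy E ` feasible V)"

definition edge_boundary :: "'a set \<Rightarrow> 'a set set \<Rightarrow> 'a set \<Rightarrow> 'a set set" where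
  "edge_boundary V E S = {e \<in> E. \<exists>u\<in>S. \<exists>v\<in>V - S. e = {u, v}}"

definition iso_number :: "'a set \<Rightarrow> 'a set set \<Rightarrow> real" where
  "iso_number V E =
     Min {real (card (edge_boundary V E S)) / real (card S) | S.
            S \<subseteq> V \<and> 0 < card S \<and> card S \<le> card V div 2}"

lemma iso_number_attained:
  assumes "finite V" "card V \<ge> 2"
  shows "\<exists>S \<subseteq> V. 0 < card S \<and> card S \<le> card V div 2 \<and>
           iso_number V E = real (card (edge_boundary V E S)) / real (card S)"
proof -
  let ?A = "{S. S \<subseteq> V \<and> 0 < card S \<and> card S \<le> card V div 2}"
  let ?f = "\<lambda>S. real (card (edge_boundary V E S)) / real (card S)"
  obtain a where a: "a \<in> V" using assms by fastforce
  have fin: "finite ?A" using assms(1) by simp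
  have "{a} \<in> ?A" using a assms by auto
  then have ne: "?A \<noteq> {}" by blast
  have "iso_number V E = Min (?f ` ?A)"
    unfolding iso_number_def by (rule arg_cong[of _ _ Min]) auto
  moreover have "Min (?f ` ?A) \<in> ?f ` ?A" using fin ne by (intro Min_in) auto
  ultimately show ?thesis by auto
qed

lemma fiedler_l1_attained:
  assumes G: "simple_graph V E" and n: "card V \<ge> 2"
  shows "\<exists>x \<in> feasible V. fiedler_l1 V E = energy E x \<and> (\<forall>y \<in> feasible V. energy E x \<le> energy E y)"
proof -
  have finV: "finite V" using G by (simp add: simple_graph_def)
  have edge: "\<exists>u\<in>V. \<exists>v\<in>V. e = {u, v}" if "e \<in> E" for e
  proof -
    have "e \<subseteq> V" "card e = 2" using G that by (auto simp: simple_graph_def)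
    then show ?thesis by (metis card_2_iff insert_subset)
  qed
  let ?B = "Pi\<^sub>E UNIV (\<lambda>i. if i \<in> V then {-1..1} else {0::real})"
  let ?K = "?B \<inter> feasible V"
  have "compactin (product_topology (\<lambda>i. euclidean) UNIV) ?B" by (simp add: compactin_PiE)
  then have "compact ?B" by (simp add: euclidean_product_topology)
  moreover have coord: "continuous_on S (\<lambda>x::'a \<Rightarrow> real. x i)" for S i
    by (rule continuous_on_subset[OF continuous_on_product_coordinates]) simp
  have "closed (feasible V)"
    unfolding feasible_def
    by (intro closed_Collect_conj closed_Collect_eq continuous_intros coord)
  ultimately have K: "compact ?K" by (rule compact_Int_closed)
  have cont: "continuous_on ?K (energy E)"
    unfolding energy_def
  proof (rule continuous_on_sum)
    fix e assume "e \<in> E"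
    then obtain u v where "e = {u, v}" using edge by blast
    then show "continuous_on ?K (\<lambda>x. edge_diff x e)"
      by (auto simp: edge_diff_insert intro!: continuous_intros coord)
  qed
  let ?r = "\<lambda>y i. if i \<in> V then y i else (0::real)"
  have red: "?r y \<in> ?K \<and> energy E (?r y) = energy E y" if y: "y \<in> feasible V" for y
  proof
    have "\<bar>y i\<bar> \<le> 1" if "i \<in> V" for i
      using member_le_sum[of i V "\<lambda>v. \<bar>y v\<bar>"] that finV y by (simp add: feasible_def)
    then have "?r y \<in> ?B" by (auto simp: abs_le_iff minus_le_iff)
    moreover have "?r y \<in> feasible V" using y by (simp add: feasible_def if_distrib cong: sum.cong)
    ultimately show "?r y \<in> ?K" by blast
    show "energy E (?r y) = energy E y"
      unfolding energy_def
    proof (rule sum.cong)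
      fix e assume "e \<in> E"
      then obtain u v where "u \<in> V" "v \<in> V" "e = {u, v}" using edge by blast
      then show "edge_diff (?r y) e = edge_diff y e" by (simp add: edge_diff_insert)
    qed simp
  qed
  obtain a b where ab: "a \<in> V" "b \<in> V" "a \<noteq> b"
    using n card_le_Suc0_iff_eq[OF finV] by fastforce
  define z where "z i = (if i = a then 1/2 else 0) + (if i = b then - (1/2) else (0::real))" for i
  have "(\<Sum>v\<in>V. z v) = 0" using ab finV by (simp add: z_def sum.distrib)
  moreover have "(\<Sum>v\<in>V. \<bar>z v\<bar>) = 1"
  proof -
    have "\<bar>z v\<bar> = (if v = a then 1/2 else 0) + (if v = b then 1/2 else 0)" for v
      using ab(3) by (simp add: z_def)
    then show ?thesis using ab finV by (simp add: sum.distrib)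
  qed
  ultimately have "z \<in> feasible V" by (simp add: feasible_def)
  from red[OF this] have "?K \<noteq> {}" by (metis empty_iff)
  from continuous_attains_inf[OF K this cont]
  obtain x where x: "x \<in> ?K" "\<forall>y\<in>?K. energy E x \<le> energy E y" by (rule bexE)
  have min: "energy E x \<le> energy E y" if "y \<in> feasible V" for y
    using bspec[OF x(2) conjunct1[OF red[OF that]]] red[OF that] by linarith
  have "fiedler_l1 V E = energy E x"
    unfolding fiedler_l1_def using x(1) min by (intro Least_equality) auto
  then show ?thesis using x(1) min by blast
qed

end

theory Submission
  imports Defs
begin

text \<open>For an optimal \<open>S\<close>, test \<open>b(G)\<close> on the vector that is constant on \<open>S\<close> and on its
  complement, with total mass \<open>1/2\<close> on \<open>S\<close> and \<open>-1/2\<close> on the complement. It jumps by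
  \<open>1/(2|S|) + 1/(2|S\<^sup>c|) \<le> 1/|S|\<close> across each boundary edge and is constant along all other edges.\<close>

definition cut_vector :: "'a set \<Rightarrow> 'a set \<Rightarrow> 'a \<Rightarrow> real" where
  "cut_vector V S v = (if v \<in> S then 1 / (2 * real (card S)) else - 1 / (2 * real (card (V - S))))"

lemma sum_split_const:
  fixes a b :: real
  assumes "finite V" "S \<subseteq> V"
  shows "(\<Sum>v\<in>V. if v \<in> S then a else b) = real (card S) * a + real (card (V - S)) * b"
  using assms by (simp add: sum.If_cases Int_absorb1 Diff_eq)

text \<open>Each side carries absolute mass 1/2, with opposite signs, so the sum cancels and the
  absolute values add up to 1. Both sides must be nonempty, since an empty one would contribute 0
  instead of 1/2.\<close>

lemma cut_vector_feasible:
  assumes "finite V" "S \<subseteq> V" "card S > 0" "card (V - S) > 0"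
  shows "cut_vector V S \<in> feasible V"
proof -
  have "\<bar>cut_vector V S v\<bar>
      = (if v \<in> S then 1 / (2 * real (card S)) else 1 / (2 * real (card (V - S))))" for v
    by (simp add: cut_vector_def)
  then show ?thesis
    using assms by (auto simp: feasible_def cut_vector_def sum_split_const)
qed

lemma energy_cut_vector:
  assumes G: "simple_graph V E" and "S \<subseteq> V"
  shows "energy E (cut_vector V S)
    = real (card (edge_boundary V E S)) * (1 / (2 * real (card S)) + 1 / (2 * real (card (V - S))))"
    (is "_ = _ * ?c")
proof -
  have "E \<subseteq> Pow V" "finite V" using G by (auto simp: simple_graph_def)
  then have fin: "finite E" by (meson finite_Pow_iff finite_subset)
  have edge: "edge_diff (cut_vector V S) e = (if e \<in> edge_boundary V E S then ?c else 0)"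
    if "e \<in> E" for e
  proof -
    have "e \<subseteq> V" "card e = 2" using G that by (auto simp: simple_graph_def)
    then obtain u v where uv: "e = {u, v}" "u \<in> V" "v \<in> V" by (metis card_2_iff insert_subset)
    \<comment> \<open>Edges are unordered, so either endpoint may be the one in
      \<open>S\<close>.\<close>
    have "e \<in> edge_boundary V E S \<longleftrightarrow> (u \<in> S) \<noteq> (v \<in> S)"
      using that uv by (auto simp: edge_boundary_def doubleton_eq_iff)
    \<comment> \<open>The values on the two sides have opposite signs, so the jump across a boundary
      edge is the sum of their absolute values.\<close>
    moreover have "0 \<le> 1 / (2 * real (card S))" "0 \<le> 1 / (2 * real (card (V - S)))"
      by simp_all
    ultimately show ?thesis
      unfolding uv(1) edge_diff_insert cut_vector_def by (smt (verit) minus_divide_left)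
  qed
  have "edge_boundary V E S \<subseteq> E" by (auto simp: edge_boundary_def)
  then have "E \<inter> edge_boundary V E S = edge_boundary V E S" by blast
  then show ?thesis
    using fin edge by (simp add: energy_def sum.If_cases)
qed

theorem theorem6p4:
  fixes V :: "'a set" and E :: "'a set set"
  assumes "simple_graph V E" and "card V \<ge> 2"
  shows "fiedler_l1 V E \<le> iso_number V E"
proof -
  have fin: "finite V" using assms(1) by (simp add: simple_graph_def)
  obtain S where S: "S \<subseteq> V" "0 < card S" "card S \<le> card V div 2"
    and iso: "iso_number V E = real (card (edge_boundary V E S)) / real (card S)"
    using iso_number_attained[OF fin assms(2)] by blast
  have "card (V - S) = card V - card S"
    using S(1) fin by (simp add: card_Diff_subset finite_subset)
  \<comment> \<open>This is used twice: it makes the complement nonempty, as feasibility requires,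
    and it bounds the jump by 1/|S|.\<close>
  then have le: "card S \<le> card (V - S)" using S(3) by linarith
  \<comment> \<open>The \<open>LEAST\<close> value is a lower bound on all feasible energies because
    the minimum is attained.\<close>
  have "fiedler_l1 V E \<le> energy E (cut_vector V S)"
    using fiedler_l1_attained[OF assms] cut_vector_feasible[OF fin S(1,2)] le S(2) by auto
  also have "\<dots> = real (card (edge_boundary V E S))
      * (1 / (2 * real (card S)) + 1 / (2 * real (card (V - S))))"
    by (rule energy_cut_vector[OF assms(1) S(1)])
  also have "\<dots> \<le> real (card (edge_boundary V E S)) * (1 / real (card S))"
  proof (rule mult_left_mono)
    have "1 / (2 * real (card (V - S))) \<le> 1 / (2 * real (card S))"
      using le S(2) by (intro divide_left_mono) auto
    then show "1 / (2 * real (card S)) + 1 / (2 * real (card (V - S))) \<le> 1 / real (card S)"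
      by (simp add: field_simps)
  qed simp
  finally show ?thesis using iso by simp
qed

end
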